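(* Let $k$ and $\ell$ be positive integers with $k\ge 3$, $0<\ell<k$ and $\ell\neq \frac{k}{2}$. Let $n$ be a positive integer. Then $$p(n;\overline{\mathrm{J}}_{k,\ell})=\sum_{j\in\mathbb{Z}\setminus\{0\}}(-1)^{j-1}\,p(n-M_{k,\ell}(j);\overline{\mathrm{J}}_{k,\ell})$$ $$=\sum_{j\ge 1}(-1)^{j-1}\,p(n-M_{k,\ell}(j);\overline{\mathrm{J}}_{k,\ell})+\sum_{j\ge 1}(-1)^{j-1}\,p(n-M_{k,k-\ell}(j);\overline{\mathrm{J}}_{k,\ell}).$$
   Context: For integers $k,\ell$ with $k>0$, $0\le\ell\le k$, and $j\in\mathbb{Z}$, set $M_{k,\ell}(j)=\frac{k}{2}j(j-1)+\ell j$ (the general modular figurate numbers). $\overline{\mathrm{J}}_{k,\ell}$ is the set of all positive integers congruent to $0$, $\ell$ or $-\ell$ modulo $k$. For a set $\mathrm{J}$ of positive integers and an integer $n$, $p(n;\mathrm{J})$ is the number of (unrestricted) partitions of $n$ all of whose parts lie in $\mathrm{J}$; $p(0;\mathrm{J})=1$ and $p(n;\mathrm{J})=0$ for $n<0$. Consequently all sums have only finitely many nonzero terms. *)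

theory Defs
  imports
    "HOL-Analysis.Analysis"
    "HOL-Library.Multiset"
    "HOL-Number_Theory.Cong"
begin

text \<open>The division by 2 is exact, see \<open>of_int_figurate\<close> below.\<close>

definition figurate :: "int \<Rightarrow> int \<Rightarrow> int \<Rightarrow> int" where
  "figurate k l j = k * j * (j - 1) div 2 + l * j"

lemma of_int_figurate:
  "real_of_int (figurate k l j) = of_int k / 2 * of_int j * (of_int j - 1) + of_int l * of_int j"
proof -
  have "even (k * j * (j - 1))"
    by simp
  then obtain c where c: "k * j * (j - 1) = 2 * c" ..
  then have "real_of_int k * of_int j * (of_int j - 1) = 2 * of_int c"
    by (metis of_int_1 of_int_diff of_int_mult of_int_numeral)
  then show ?thesis
    by (simp add: figurate_def c)
qed

definition Jbar :: "int \<Rightarrow> int \<Rightarrow> int set" where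
  "Jbar k l = {m. m > 0 \<and> ([m = 0] (mod k) \<or> [m = l] (mod k) \<or> [m = - l] (mod k))}"

text \<open>
  A partition is the multiset of its parts. The definition is meant for sets \<open>J\<close> of positive
  integers only; the set below is then finite (\<open>finite_partitions\<close>), so that \<^const>\<open>card\<close>
  really counts.
\<close>

definition partitions_in :: "int \<Rightarrow> int set \<Rightarrow> int multiset set" where
  "partitions_in n J = {P. set_mset P \<subseteq> J \<and> sum_mset P = n}"

definition num_partitions :: "int \<Rightarrow> int set \<Rightarrow> nat" where
  "num_partitions n J = card (partitions_in n J)"

lemma partition_bounds:
  assumes "\<forall>x\<in>#P. (x::int) > 0"
  shows "int (size P) \<le> sum_mset P \<and> (\<forall>x\<in>#P. x \<le> sum_mset P)"
  using assms
proof (induction P)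
  case empty
  then show ?case by simp
next
  case (add x P)
  then have IH: "int (size P) \<le> sum_mset P" "\<forall>y\<in>#P. y \<le> sum_mset P" "x > 0"
    by auto
  then have "y \<le> x + sum_mset P" if "y \<in># P" for y
    using that by (smt (verit))
  then show ?case
    using IH by auto
qed

lemma finite_partitions:
  assumes "\<forall>x\<in>J. x > 0"
  shows "finite (partitions_in n J)"
proof (rule finite_subset)
  show "partitions_in n J \<subseteq> mset ` {xs. set xs \<subseteq> {0..n} \<and> length xs \<le> nat n}"
  proof
    fix P assume "P \<in> partitions_in n J"
    then have P: "\<forall>x\<in>#P. x > 0" "sum_mset P = n"
      using assms by (auto simp: partitions_in_def)
    obtain xs where xs: "P = mset xs"
      by (metis ex_mset)
    have "set xs \<subseteq> {0..n} \<and> length xs \<le> nat n"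
      using partition_bounds[OF P(1)] P by (auto simp: xs less_imp_le)
    then show "P \<in> mset ` {xs. set xs \<subseteq> {0..n} \<and> length xs \<le> nat n}"
      using xs by blast
  qed
  show "finite (mset ` {xs. set xs \<subseteq> {0..n} \<and> length xs \<le> nat n})"
    by (intro finite_imageI finite_lists_length_le) simp
qed

lemma Jbar_pos: "\<forall>x\<in>Jbar k l. x > 0"
  by (simp add: Jbar_def)

lemma num_partitions_neg:
  assumes "\<forall>x\<in>J. x > 0" "n < 0"
  shows "num_partitions n J = 0"
proof -
  have "P \<notin> partitions_in n J" for P
  proof
    assume "P \<in> partitions_in n J"
    then have P: "\<forall>x\<in>#P. x > 0" "sum_mset P = n"
      using assms by (auto simp: partitions_in_def)
    show False
      using partition_bounds[OF P(1)] P(2) assms(2) by linarith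
  qed
  then have "partitions_in n J = {}"
    by blast
  then show ?thesis
    by (simp add: num_partitions_def)
qed

lemma num_partitions_0:
  assumes "\<forall>x\<in>J. x > 0"
  shows "num_partitions 0 J = 1"
proof -
  have "partitions_in 0 J = {{#}}"
  proof (intro equalityI subsetI)
    fix P assume "P \<in> partitions_in 0 J"
    then have P: "\<forall>x\<in>#P. x > 0" "sum_mset P = 0"
      using assms by (auto simp: partitions_in_def)
    show "P \<in> {{#}}"
      using partition_bounds[OF P(1)] P by simp
  qed (simp add: partitions_in_def)
  then show ?thesis
    by (simp add: num_partitions_def)
qed

lemma abs_le_figurate:
  assumes "0 < l" "l < k"
  shows "\<bar>j\<bar> \<le> figurate k l j"
proof -
  have fig: "2 * figurate k l j = k * j * (j - 1) + 2 * (l * j)"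
    by (simp add: figurate_def)
  consider "j \<ge> 1" | "j = 0" | "j \<le> -1"
    by linarith
  then show ?thesis
  proof cases
    case 1
    have "0 \<le> k * j * (j - 1)" "1 * j \<le> l * j"
      using assms 1 by (auto intro: mult_right_mono)
    then show ?thesis
      using fig 1 by linarith
  next
    case 2
    then show ?thesis
      by (simp add: figurate_def)
  next
    case 3
    have "2 * figurate k l j = k * (- j) * (- j - 1) + 2 * ((k - l) * (- j))"
      unfolding fig by (simp add: algebra_simps)
    moreover have "0 \<le> k * (- j) * (- j - 1)"
      using assms 3 by (intro mult_nonneg_nonneg) linarith+
    moreover have "1 * (- j) \<le> (k - l) * (- j)"
      using assms 3 by (intro mult_right_mono) linarith+
    ultimately show ?thesis
      using 3 by linarith
  qed
qed

text \<open>Hence the sums over \<open>j\<close> of these partition numbers have only finitely many nonzero terms, and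
  \<^const>\<open>infsum\<close> is an honest finite sum there.\<close>

lemma finite_support_figurate:
  assumes "0 < l" "l < k" "\<forall>x\<in>J. x > 0"
  shows "finite {j. num_partitions (n - figurate k l j) J \<noteq> 0}"
proof (rule finite_subset)
  show "{j. num_partitions (n - figurate k l j) J \<noteq> 0} \<subseteq> {- n..n}"
  proof
    fix j assume "j \<in> {j. num_partitions (n - figurate k l j) J \<noteq> 0}"
    then have "figurate k l j \<le> n"
      using num_partitions_neg[OF assms(3), of "n - figurate k l j"]
      by (cases "figurate k l j \<le> n") auto
    then show "j \<in> {- n..n}"
      using abs_le_figurate[OF assms(1,2), of j] by auto
  qed
qed simp

end

theory Submission
  imports Defs "HOL-Computational_Algebra.Formal_Power_Series"
begin

text \<open>
  Write \<open>J\<close> for \<open>Jbar k l\<close> and \<open>M j\<close> for \<open>figurate k l j\<close>. The generating function of the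
  partitions with parts in \<open>J\<close> is the inverse of \<open>\<Prod>m\<in>J. 1 - X ^ m\<close>. Since \<open>0 < l < k\<close> and
  \<open>2 * l \<noteq> k\<close>, the classes of \<open>0\<close>, \<open>l\<close> and \<open>- l\<close> modulo \<open>k\<close> are distinct, and that product is
  \<open>\<Prod>i\<ge>0. (1 - X ^ (k * (i + 1))) * (1 - X ^ (l + k * i)) * (1 - X ^ (k - l + k * i))\<close>. By
  Jacobi's triple product identity it equals \<open>\<Sum>j. (-1) ^ j * X ^ M j\<close>, the sum over all integers.
  Hence this theta series times the generating function is \<open>1\<close>, and its coefficient at \<open>n > 0\<close>
  vanishes; the term \<open>j = 0\<close>, where \<open>M 0 = 0\<close>, gives the first equation. The second one splits the
  sum by the sign of \<open>j\<close> and uses \<open>figurate k l (- j) = figurate k (k - l) j\<close>.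

  No infinite products are needed, because one coefficient only depends on a truncation. The triple
  product enters in a finite form (\<open>finite_triple_product\<close>), valid in every commutative
  ring, whose coefficients are Gaussian binomials in \<open>q = a * b\<close>; it follows by
  induction from the two q-Pascal rules. With \<open>a = X ^ l\<close> and \<open>b = X ^ (k - l)\<close>, the product of the
  factors \<open>1 - q ^ i\<close> cancels the Gaussian binomials up to terms of high order
  (\<open>triple_product_agree\<close>), and \<open>sum_partitions_figurate_eq_0\<close> compares coefficients.
\<close>

unbundle no vec_syntax
unbundle fps_syntax

section \<open>Gaussian binomial coefficients\<close>

text \<open>
  The Gaussian binomial coefficient \<open>[n, r]\<close> at \<open>q\<close>. It is defined by a q-Pascal rule and not as a
  quotient, so that it makes sense for every element \<open>q\<close> of a commutative ring.
\<close>

fun qbinomial :: "'a::comm_ring_1 \<Rightarrow> nat \<Rightarrow> nat \<Rightarrow> 'a" where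
  "qbinomial q n 0 = 1"
| "qbinomial q 0 (Suc r) = 0"
| "qbinomial q (Suc n) (Suc r) = qbinomial q n r + q ^ Suc r * qbinomial q n (Suc r)"

lemma qbinomial_eq_0: "n < r \<Longrightarrow> qbinomial q n r = 0"
  by (induction q n r rule: qbinomial.induct) auto

text \<open>The second q-Pascal rule, with the power of \<open>q\<close> on the other summand.\<close>

lemma qbinomial_Suc_Suc_alt:
  assumes "r \<le> n"
  shows "qbinomial q (Suc n) (Suc r) = qbinomial q n (Suc r) + q ^ (n - r) * qbinomial q n r"
  using assms
proof (induction n arbitrary: r)
  case 0
  then show ?case by simp
next
  case (Suc n)
  show ?case
  proof (cases "r = Suc n")
    case True
    then show ?thesis
      by (simp add: qbinomial_eq_0)
  next
    case False
    then have r: "r \<le> n"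
      using Suc.prems by simp
    show ?thesis
    proof (cases r)
      case 0
      have "qbinomial q (Suc (Suc n)) (Suc 0)
          = 1 + q * (qbinomial q n (Suc 0) + q ^ n)"
        using Suc.IH[of 0] by simp
      then show ?thesis
        unfolding 0 by (simp add: algebra_simps)
    next
      case (Suc r')
      have 1: "qbinomial q (Suc n) r = qbinomial q n r + q ^ (Suc n - r) * qbinomial q n r'"
        using Suc.IH[of r'] r Suc by simp
      have 2: "qbinomial q (Suc n) (Suc r)
          = qbinomial q n (Suc r) + q ^ (n - r) * qbinomial q n r"
        using Suc.IH[of r] r by simp
      have pw: "q ^ Suc r * q ^ (n - r) = q ^ Suc n" "q ^ (Suc n - r) * q ^ r = q ^ Suc n"
        using r by (simp_all flip: power_add del: power_Suc)
      have "qbinomial q (Suc (Suc n)) (Suc r)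
          = qbinomial q (Suc n) r + q ^ Suc r * qbinomial q (Suc n) (Suc r)"
        by simp
      also have "\<dots> = qbinomial q n r + q ^ (Suc n - r) * qbinomial q n r'
          + q ^ Suc r * qbinomial q n (Suc r) + (q ^ Suc r * q ^ (n - r)) * qbinomial q n r"
        unfolding 1 2 by (simp only: algebra_simps)
      also have "\<dots> = (qbinomial q n r + q ^ Suc r * qbinomial q n (Suc r))
          + q ^ (Suc n - r) * (qbinomial q n r' + q ^ r * qbinomial q n r)"
        unfolding pw(1) pw(2)[symmetric] by (simp only: algebra_simps)
      also have "\<dots> = qbinomial q (Suc n) (Suc r) + q ^ (Suc n - r) * qbinomial q (Suc n) r"
        unfolding Suc by simp
      finally show ?thesis .
    qed
  qed
qed

text \<open>The finite q-Pochhammer symbol \<open>(1 - q) * (1 - q ^ 2) * \<dots> * (1 - q ^ n)\<close>.\<close>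

definition qpoch :: "'a::comm_ring_1 \<Rightarrow> nat \<Rightarrow> 'a" where
  "qpoch q n = (\<Prod>i<n. 1 - q ^ Suc i)"

text \<open>The quotient formula for Gaussian binomials, without division.\<close>

lemma qbinomial_qpoch:
  assumes "r \<le> n"
  shows "qbinomial q n r * qpoch q r * qpoch q (n - r) = qpoch q n"
  using assms
proof (induction q n r rule: qbinomial.induct)
  case (1 q n)
  then show ?case by (simp add: qpoch_def)
next
  case (2 q r)
  then show ?case by simp
next
  case (3 q n r)
  have r: "r \<le> n"
    using "3.prems" by simp
  have A: "qbinomial q n r * qpoch q (Suc r) * qpoch q (n - r) = (1 - q ^ Suc r) * qpoch q n"
    using "3.IH"(1)[OF r] by (simp add: qpoch_def algebra_simps)
  have B: "qbinomial q n (Suc r) * qpoch q (Suc r) * qpoch q (n - r) = (1 - q ^ (n - r)) * qpoch q n"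
  proof (cases "r = n")
    case True
    then show ?thesis by (simp add: qbinomial_eq_0)
  next
    case False
    then have "n - r = Suc (n - Suc r)"
      using r by simp
    then have "qpoch q (n - r) = (1 - q ^ (n - r)) * qpoch q (n - Suc r)"
      by (simp add: qpoch_def)
    then have "qbinomial q n (Suc r) * qpoch q (Suc r) * qpoch q (n - r)
        = (1 - q ^ (n - r)) * (qbinomial q n (Suc r) * qpoch q (Suc r) * qpoch q (n - Suc r))"
      by (simp only: mult_ac)
    then show ?thesis
      using "3.IH"(2) False r by simp
  qed
  have "q ^ Suc r * q ^ (n - r) = q ^ Suc n"
    using r by (simp flip: power_add del: power_Suc)
  then have coeff: "(1 - q ^ Suc r) + q ^ Suc r * (1 - q ^ (n - r)) = 1 - q ^ Suc n"
    by (simp add: right_diff_distrib)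
  have "qbinomial q (Suc n) (Suc r) * qpoch q (Suc r) * qpoch q (Suc n - Suc r)
      = qbinomial q n r * qpoch q (Suc r) * qpoch q (n - r)
        + q ^ Suc r * (qbinomial q n (Suc r) * qpoch q (Suc r) * qpoch q (n - r))"
    by (simp add: distrib_right mult.assoc)
  also have "\<dots> = ((1 - q ^ Suc r) + q ^ Suc r * (1 - q ^ (n - r))) * qpoch q n"
    unfolding A B by (simp only: distrib_right mult.assoc)
  also have "\<dots> = qpoch q (Suc n)"
    unfolding coeff by (simp add: qpoch_def mult.commute)
  finally show ?case .
qed

section \<open>The finite triple product identity\<close>

text \<open>
  The number \<open>j * (j - 1) / 2\<close>, which is a natural number for every integer \<open>j\<close>; the division
  is exact.
\<close>

definition tri :: "int \<Rightarrow> nat" where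
  "tri j = nat (j * (j - 1) div 2)"

lemma two_tri: "2 * int (tri j) = j * (j - 1)"
proof -
  have "even (j * (j - 1))" by simp
  moreover have "j * (j - 1) \<ge> 0"
    by (cases "j \<le> 0") (auto intro: mult_nonneg_nonneg mult_nonpos_nonpos)
  ultimately show ?thesis
    by (simp add: tri_def)
qed

lemma tri_add_1: "int (tri (j + 1)) = int (tri j) + j"
proof -
  have "2 * int (tri (j + 1)) = 2 * (int (tri j) + j)"
    unfolding two_tri distrib_left by (simp add: algebra_simps)
  then show ?thesis by simp
qed

text \<open>
  The summand with index \<open>j\<close> of Ramanujan's theta function of \<open>a\<close> and \<open>b\<close>, without its sign. As both
  exponents are natural numbers, negative \<open>j\<close> need no inverses.
\<close>

definition theta_term :: "'a::comm_ring_1 \<Rightarrow> 'a \<Rightarrow> int \<Rightarrow> 'a" where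
  "theta_term a b j = a ^ tri (j + 1) * b ^ tri j"

text \<open>
  Multiplying by the new term of a factor \<open>1 - a * q ^ m\<close> or \<open>1 - b * q ^ n\<close>, where \<open>q = a * b\<close>,
  moves the index of a theta summand by one, up to a power of \<open>q\<close>. These are the powers in
  the q-Pascal rules.
\<close>

lemma theta_term_up:
  assumes "int s = int m - j"
  shows "a * (a * b) ^ m * theta_term a b j = (a * b) ^ s * theta_term a b (j + 1)"
proof -
  have "Suc (m + tri (j + 1)) = s + tri (j + 2)" "m + tri j = s + tri (j + 1)"
    using assms tri_add_1[of j] tri_add_1[of "j + 1"] by (simp_all add: add.assoc)
  moreover have "a * (a * b) ^ m * theta_term a b j = a ^ Suc (m + tri (j + 1)) * b ^ (m + tri j)"
    by (simp add: theta_term_def power_mult_distrib power_add algebra_simps)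
  moreover have "(a * b) ^ s * theta_term a b (j + 1) = a ^ (s + tri (j + 2)) * b ^ (s + tri (j + 1))"
    by (simp add: theta_term_def power_mult_distrib power_add algebra_simps)
  ultimately show ?thesis by simp
qed

lemma theta_term_down:
  assumes "int s = int n + j"
  shows "b * (a * b) ^ n * theta_term a b j = (a * b) ^ s * theta_term a b (j - 1)"
proof -
  have "n + tri (j + 1) = s + tri j" "Suc (n + tri j) = s + tri (j - 1)"
    using assms tri_add_1[of j] tri_add_1[of "j - 1"] by simp_all
  moreover have "b * (a * b) ^ n * theta_term a b j = a ^ (n + tri (j + 1)) * b ^ Suc (n + tri j)"
    by (simp add: theta_term_def power_mult_distrib power_add algebra_simps)
  moreover have "(a * b) ^ s * theta_term a b (j - 1) = a ^ (s + tri j) * b ^ (s + tri (j - 1))"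
    by (simp add: theta_term_def power_mult_distrib power_add algebra_simps)
  ultimately show ?thesis by simp
qed

text \<open>
  The summand with index \<open>r\<close> belongs to the theta index \<open>j = r - n\<close>, which ranges from \<open>- n\<close> to \<open>m\<close>;
  the sign \<open>(-1) ^ j\<close> is written as \<open>(-1) ^ (r + n)\<close>. A factor \<open>1 - a * q ^ m\<close> is added with
  the second q-Pascal rule, a factor \<open>1 - b * q ^ n\<close> with the first.
\<close>

theorem finite_triple_product:
  fixes a b :: "'a::comm_ring_1"
  shows "(\<Prod>i<m. 1 - a * (a * b) ^ i) * (\<Prod>i<n. 1 - b * (a * b) ^ i)
    = (\<Sum>r\<le>m + n. (-1) ^ (r + n) * theta_term a b (int r - int n) * qbinomial (a * b) (m + n) r)"
    (is "?A m * ?B n = ?S m n")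
proof (induction n)
  case 0
  show ?case
  proof (induction m)
    case 0
    show ?case by (simp add: theta_term_def tri_def)
  next
    case (Suc m)
    define t where "t = theta_term a b"
    define Q where "Q = qbinomial (a * b)"
    have up: "(a * b) ^ (m - r) * t (int (Suc r)) = a * (a * b) ^ m * t (int r)" if "r \<le> m" for r
      using theta_term_up[of "m - r" m "int r" a b] that by (simp add: t_def add.commute)
    \<comment> \<open>The term \<open>r = 0\<close> is split off, so that the q-Pascal rule applies to all others.\<close>
    have "?S (Suc m) 0 = Q (Suc m) 0 * t 0
        + (\<Sum>r\<le>m. (-1) ^ Suc r * t (int (Suc r)) * Q (Suc m) (Suc r))"
      by (simp add: sum.atMost_Suc_shift t_def Q_def del: sum.atMost_Suc qbinomial.simps(3))
    also have "(\<Sum>r\<le>m. (-1) ^ Suc r * t (int (Suc r)) * Q (Suc m) (Suc r))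
        = (\<Sum>r\<le>m. (-1) ^ Suc r * t (int (Suc r)) * Q m (Suc r)
            - a * (a * b) ^ m * ((-1) ^ r * t (int r) * Q m r))"
    proof (rule sum.cong[OF refl], goal_cases)
      case (1 r)
      then have r: "r \<le> m" by simp
      have "(-1) ^ Suc r * t (int (Suc r)) * Q (Suc m) (Suc r)
          = (-1) ^ Suc r * t (int (Suc r)) * Q m (Suc r)
            - (-1) ^ r * ((a * b) ^ (m - r) * t (int (Suc r))) * Q m r"
        unfolding Q_def qbinomial_Suc_Suc_alt[OF r] by (simp add: algebra_simps)
      also have "\<dots> = (-1) ^ Suc r * t (int (Suc r)) * Q m (Suc r)
            - a * (a * b) ^ m * ((-1) ^ r * t (int r) * Q m r)"
        unfolding up[OF r] by (simp only: mult_ac)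
      finally show ?case .
    qed
    also have "Q (Suc m) 0 * t 0 + \<dots> = (Q m 0 * t 0 + (\<Sum>r\<le>m. (-1) ^ Suc r * t (int (Suc r)) * Q m (Suc r)))
        - a * (a * b) ^ m * (\<Sum>r\<le>m. (-1) ^ r * t (int r) * Q m r)"
      by (simp add: sum_subtractf sum_distrib_left Q_def)
    also have "Q m 0 * t 0 + (\<Sum>r\<le>m. (-1) ^ Suc r * t (int (Suc r)) * Q m (Suc r))
        = (\<Sum>r\<le>Suc m. (-1) ^ r * t (int r) * Q m r)"
      by (simp add: sum.atMost_Suc_shift del: sum.atMost_Suc)
    also have "\<dots> = (\<Sum>r\<le>m. (-1) ^ r * t (int r) * Q m r)"
      by (simp add: Q_def qbinomial_eq_0)
    finally have "?S (Suc m) 0 = (1 - a * (a * b) ^ m) * ?S m 0"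
      by (simp add: t_def Q_def algebra_simps)
    then show ?case
      using Suc by (simp add: algebra_simps)
  qed
next
  case (Suc n)
  define t where "t = theta_term a b"
  define Q where "Q = qbinomial (a * b)"
  define s where "s = m + n"
  define f where "f r = (-1) ^ (r + n) * t (int r - int n) * Q s r" for r
  have down: "(a * b) ^ r * t (int r - int (Suc n)) = b * (a * b) ^ n * t (int r - int n)" for r
    using theta_term_down[of r n "int r - int n" b a] by (simp add: t_def algebra_simps)
  have "?S m (Suc n) = (\<Sum>r\<le>Suc s. (-1) ^ (r + Suc n) * t (int r - int (Suc n)) * Q (Suc s) r)"
    by (simp only: s_def t_def Q_def add_Suc_right)
  also have "\<dots> = (-1) ^ Suc n * t (- int (Suc n))
      + (\<Sum>r\<le>s. (-1) ^ (r + n) * t (int r - int n) * Q (Suc s) (Suc r))"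
    by (subst sum.atMost_Suc_shift) (simp add: Q_def)
  also have "(-1) ^ Suc n * t (- int (Suc n)) = - (b * (a * b) ^ n * f 0)"
    using down[of 0] by (simp add: f_def Q_def algebra_simps)
  also have "(\<Sum>r\<le>s. (-1) ^ (r + n) * t (int r - int n) * Q (Suc s) (Suc r))
      = (\<Sum>r\<le>s. f r - b * (a * b) ^ n * f (Suc r))"
  proof (rule sum.cong[OF refl], goal_cases)
    case (1 r)
    have "(-1) ^ (r + n) * t (int r - int n) * Q (Suc s) (Suc r)
        = f r + (-1) ^ (r + n) * ((a * b) ^ Suc r * t (int (Suc r) - int (Suc n))) * Q s (Suc r)"
      by (simp add: f_def Q_def algebra_simps)
    also have "\<dots> = f r - b * (a * b) ^ n * f (Suc r)"
      unfolding down by (simp add: f_def mult_ac)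
    finally show ?case .
  qed
  also have "- (b * (a * b) ^ n * f 0) + \<dots> = sum f {..s} - b * (a * b) ^ n * (f 0 + (\<Sum>r\<le>s. f (Suc r)))"
    by (simp add: sum_subtractf sum_distrib_left algebra_simps)
  also have "f 0 + (\<Sum>r\<le>s. f (Suc r)) = sum f {..Suc s}"
    by (subst sum.atMost_Suc_shift) simp
  also have "\<dots> = sum f {..s}"
    by (simp add: f_def Q_def qbinomial_eq_0)
  finally have "?S m (Suc n) = (1 - b * (a * b) ^ n) * ?S m n"
    by (simp add: f_def t_def Q_def s_def algebra_simps)
  then show ?case
    using Suc by (simp add: algebra_simps)
qed

section \<open>Generating functions of partitions\<close>

text \<open>The generating function of the numbers of partitions with all parts in \<open>J\<close>.\<close>

definition partitions_fps :: "int set \<Rightarrow> real fps" where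
  "partitions_fps J = Abs_fps (\<lambda>n. real (num_partitions (int n) J))"

text \<open>Parts larger than \<open>n\<close> do not occur in a partition of \<open>n\<close>.\<close>

lemma num_partitions_restrict_parts:
  assumes "\<forall>x\<in>J. x > 0" "J \<inter> {..N} \<subseteq> S" "S \<subseteq> J" "n \<le> N"
  shows "num_partitions n S = num_partitions n J"
proof -
  have sub: "set_mset P \<subseteq> S" if P: "set_mset P \<subseteq> J" "sum_mset P = n" for P
  proof
    fix x assume x: "x \<in># P"
    have "\<forall>y\<in>#P. y > 0"
      using P(1) assms(1) by blast
    then have "x \<le> sum_mset P"
      using partition_bounds x by blast
    then show "x \<in> S"
      using x P assms(2,4) by auto
  qed
  have "partitions_in n S = partitions_in n J"
  proof
    show "partitions_in n S \<subseteq> partitions_in n J"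
      using assms(3) unfolding partitions_in_def by blast
    show "partitions_in n J \<subseteq> partitions_in n S"
      using sub unfolding partitions_in_def by blast
  qed
  then show ?thesis by (simp add: num_partitions_def)
qed

text \<open>
  A partition with parts in \<open>insert m S\<close> either does not use \<open>m\<close>, or one copy of \<open>m\<close> can be removed.
\<close>

lemma num_partitions_insert:
  assumes "\<forall>x\<in>S. x > 0" "m > 0" "m \<notin> S"
  shows "num_partitions n (insert m S)
    = num_partitions n S + num_partitions (n - m) (insert m S)"
proof -
  have fin: "finite (partitions_in j (insert m S))" "finite (partitions_in j S)" for j
    using assms by (auto intro!: finite_partitions)
  have eq: "partitions_in n (insert m S)
      = partitions_in n S \<union> add_mset m ` partitions_in (n - m) (insert m S)"
  proof (intro equalityI subsetI)
    fix P assume P: "P \<in> partitions_in n (insert m S)"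
    show "P \<in> partitions_in n S \<union> add_mset m ` partitions_in (n - m) (insert m S)"
    proof (cases "m \<in># P")
      case True
      then obtain R where "P = add_mset m R"
        by (metis insert_DiffM)
      then show ?thesis
        using P by (auto simp: partitions_in_def)
    next
      case False
      then show ?thesis
        using P by (auto simp: partitions_in_def)
    qed
  qed (auto simp: partitions_in_def)
  have "partitions_in n S \<inter> add_mset m ` partitions_in (n - m) (insert m S) = {}"
  proof (intro equals0I)
    fix P assume "P \<in> partitions_in n S \<inter> add_mset m ` partitions_in (n - m) (insert m S)"
    then obtain R where "set_mset P \<subseteq> S" "P = add_mset m R"
      unfolding partitions_in_def by blast
    then show False
      using assms(3) by simp
  qed
  then have "card (partitions_in n (insert m S)) = card (partitions_in n S)
      + card (add_mset m ` partitions_in (n - m) (insert m S))"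
    using card_Un_disjoint[OF fin(2) finite_imageI[OF fin(1)]] eq by metis
  then show ?thesis
    unfolding num_partitions_def by (simp add: card_image inj_on_def)
qed

lemma partitions_fps_prod:
  assumes "finite S" "\<forall>x\<in>S. x > 0"
  shows "partitions_fps S * (\<Prod>m\<in>S. 1 - fps_X ^ nat m) = 1"
  using assms
proof (induction S)
  case empty
  have "partitions_in n {} = (if n = 0 then {{#}} else {})" for n
    by (auto simp: partitions_in_def)
  then show ?case
    by (simp add: partitions_fps_def num_partitions_def fps_eq_iff)
next
  case (insert m S)
  have "partitions_fps (insert m S) = partitions_fps S + fps_X ^ nat m * partitions_fps (insert m S)"
  proof (rule fps_ext)
    fix n
    show "partitions_fps (insert m S) $ n
      = (partitions_fps S + fps_X ^ nat m * partitions_fps (insert m S)) $ n"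
    proof (cases "int n < m")
      case True
      then have "num_partitions (int n - m) (insert m S) = 0"
        using insert.prems by (intro num_partitions_neg) auto
      then show ?thesis
        using True num_partitions_insert[of S m "int n"] insert
        by (simp add: partitions_fps_def fps_X_power_mult_nth)
    next
      case False
      then have "int (n - nat m) = int n - m" "\<not> n < nat m"
        using insert.prems by auto
      then show ?thesis
        using num_partitions_insert[of S m "int n"] insert
        by (simp add: partitions_fps_def fps_X_power_mult_nth)
    qed
  qed
  then have "partitions_fps (insert m S) * (1 - fps_X ^ nat m) = partitions_fps S"
    by (simp add: algebra_simps)
  then show ?case
    using insert by (simp add: mult.assoc[symmetric])
qed

section \<open>The triple product modulo a power of X\<close>

text \<open>Congruence of formal power series modulo \<open>X ^ K\<close>.\<close>

definition fps_agree :: "nat \<Rightarrow> 'a::field fps \<Rightarrow> 'a fps \<Rightarrow> bool" where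
  "fps_agree K f g \<longleftrightarrow> (\<forall>i<K. f $ i = g $ i)"

lemma fps_agree_refl: "fps_agree K f f"
  by (simp add: fps_agree_def)

lemma fps_agree_sym: "fps_agree K f g \<Longrightarrow> fps_agree K g f"
  by (simp add: fps_agree_def)

lemma fps_agree_trans: "fps_agree K f g \<Longrightarrow> fps_agree K g h \<Longrightarrow> fps_agree K f h"
  by (simp add: fps_agree_def)

lemma fps_agree_mult:
  "fps_agree K f g \<Longrightarrow> fps_agree K f' g' \<Longrightarrow> fps_agree K (f * f') (g * g')"
  by (simp add: fps_agree_def fps_mult_nth)

lemma fps_agree_sum:
  "(\<And>x. x \<in> A \<Longrightarrow> fps_agree K (f x) (g x)) \<Longrightarrow> fps_agree K (sum f A) (sum g A)"
  by (simp add: fps_agree_def fps_sum_nth)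

lemma fps_agree_X_power_0: "K \<le> e \<Longrightarrow> fps_agree K (fps_X ^ e) 0"
  by (simp add: fps_agree_def)

lemma fps_agree_mult_lcancel:
  assumes "f $ 0 \<noteq> 0" "fps_agree K (f * g) (f * h)"
  shows "fps_agree K g h"
  using fps_agree_mult[OF fps_agree_refl[of K "inverse f"] assms(2)] inverse_mult_eq_1[OF assms(1)]
  by (simp add: mult.assoc[symmetric])

lemma qpoch_agree:
  assumes "d > 0" "K \<le> M"
  shows "fps_agree K (qpoch (fps_X ^ d) M) (qpoch (fps_X ^ d) K)"
proof -
  let ?q = "fps_X ^ d :: 'a fps"
  have "fps_agree K (qpoch ?q (K + e)) (qpoch ?q K)" for e
  proof (induction e)
    case 0
    show ?case by (simp add: fps_agree_refl)
  next
    case (Suc e)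
    have "1 * Suc (K + e) \<le> d * Suc (K + e)"
      using assms(1) by (intro mult_le_mono1) linarith
    then have "K \<le> d * Suc (K + e)"
      using le_trans[of K "Suc (K + e)"] by simp
    then have "fps_agree K (fps_X ^ (d * Suc (K + e)) :: 'a fps) 0"
      by (rule fps_agree_X_power_0)
    then have "fps_agree K (?q ^ Suc (K + e)) 0"
      by (simp only: power_mult)
    then have "fps_agree K (1 - ?q ^ Suc (K + e)) 1"
      by (simp add: fps_agree_def del: power_Suc)
    from fps_agree_mult[OF Suc this]
    have "fps_agree K (qpoch ?q (K + e) * (1 - ?q ^ Suc (K + e))) (qpoch ?q K)"
      by (simp only: mult_1_right)
    moreover have "qpoch ?q (K + Suc e) = qpoch ?q (K + e) * (1 - ?q ^ Suc (K + e))"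
      by (simp only: qpoch_def add_Suc_right prod.lessThan_Suc)
    ultimately show ?case by (simp only:)
  qed
  from this[of "M - K"] show ?thesis
    using assms(2) by simp
qed

text \<open>
  Far from both ends of its row, a Gaussian binomial is inverse to the q-Pochhammer symbol modulo
  \<open>X ^ K\<close>: the three symbols in the quotient formula all agree with \<open>qpoch q K\<close>.
\<close>

lemma qpoch_qbinomial_agree:
  assumes "d > 0" "K \<le> r" "r + K \<le> n" "K \<le> M"
  shows "fps_agree K (qpoch (fps_X ^ d) M * qbinomial (fps_X ^ d) n r) 1"
proof -
  let ?q = "fps_X ^ d :: 'a fps"
  let ?f = "qpoch ?q K"
  let ?g = "qbinomial ?q n r"
  have "?f $ 0 = (\<Prod>i<K. (1 - ?q ^ Suc i) $ 0)"
    by (simp add: qpoch_def fps_prod_nth')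
  also have "\<dots> = 1"
    using assms(1) by (intro prod.neutral) (simp flip: power_mult power_Suc)
  \<comment> \<open>A nonzero constant term makes \<open>?f\<close> cancellable modulo \<open>X ^ K\<close>.\<close>
  finally have f0: "?f $ 0 \<noteq> 0" by simp
  have "qpoch ?q n = ?g * qpoch ?q r * qpoch ?q (n - r)"
    using assms by (intro qbinomial_qpoch[symmetric]) simp
  also have "fps_agree K \<dots> (?g * ?f * ?f)"
    using assms by (intro fps_agree_mult qpoch_agree fps_agree_refl) auto
  finally have "fps_agree K (?g * ?f * ?f) (qpoch ?q n)"
    by (rule fps_agree_sym)
  moreover have "fps_agree K (qpoch ?q n) ?f"
    using assms by (intro qpoch_agree) auto
  ultimately have "fps_agree K (?g * ?f * ?f) ?f"
    by (rule fps_agree_trans)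
  then have "fps_agree K (?f * (?f * ?g)) (?f * 1)"
    by (simp only: mult_ac mult_1_right mult_1_left)
  with f0 have "fps_agree K (?f * ?g) 1"
    by (rule fps_agree_mult_lcancel)
  moreover have "fps_agree K (qpoch ?q M * ?g) (?f * ?g)"
    using assms by (intro fps_agree_mult qpoch_agree fps_agree_refl) auto
  ultimately show ?thesis
    using fps_agree_trans by metis
qed

lemma theta_term_fps_X:
  assumes "0 < l" "l < k"
  shows "theta_term (fps_X ^ nat l) (fps_X ^ nat (k - l)) j
    = (fps_X ^ nat (figurate k l j) :: 'a::comm_ring_1 fps)"
proof -
  have "2 * figurate k l j = k * (j * (j - 1)) + 2 * (l * j)"
    by (simp add: figurate_def mult.assoc)
  also have "\<dots> = 2 * (k * int (tri j) + l * j)"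
    by (simp flip: two_tri)
  also have "k * int (tri j) + l * j = int (nat l * tri (j + 1) + nat (k - l) * tri j)"
    using assms by (simp add: tri_add_1 distrib_left left_diff_distrib mult.commute)
  finally have "nat (figurate k l j) = nat l * tri (j + 1) + nat (k - l) * tri j"
    by (metis mult_cancel_left nat_int zero_neq_numeral)
  then show ?thesis
    by (simp add: theta_term_def power_add power_mult)
qed

text \<open>
  Indices \<open>j = r - N\<close> with \<open>\<bar>j\<bar> \<le> N - K\<close> have a Gaussian binomial that cancels modulo \<open>X ^ K\<close>. For all
  others \<open>figurate k l j \<ge> \<bar>j\<bar> \<ge> K\<close>, so that their summands vanish modulo \<open>X ^ K\<close>; this is why
  \<open>N = 2 * K\<close> is large enough.
\<close>

lemma triple_product_agree:
  assumes "0 < l" "l < k" "N = 2 * K"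
  shows "fps_agree K
    (qpoch (fps_X ^ nat k) N * ((\<Prod>i<N. 1 - fps_X ^ nat l * (fps_X ^ nat k) ^ i)
      * (\<Prod>i<N. 1 - fps_X ^ nat (k - l) * (fps_X ^ nat k) ^ i)))
    (\<Sum>r\<le>N + N. (-1) ^ (r + N) * fps_X ^ nat (figurate k l (int r - int N)))"
proof -
  let ?q = "fps_X ^ nat k :: 'a fps"
  let ?e = "\<lambda>r. nat (figurate k l (int r - int N))"
  have ab: "fps_X ^ nat l * fps_X ^ nat (k - l) = ?q"
    using assms by (simp flip: power_add nat_add_distrib)
  have eq: "qpoch ?q N * ((\<Prod>i<N. 1 - fps_X ^ nat l * ?q ^ i) * (\<Prod>i<N. 1 - fps_X ^ nat (k - l) * ?q ^ i))
      = (\<Sum>r\<le>N + N. (-1) ^ (r + N) * fps_X ^ ?e r * (qpoch ?q N * qbinomial ?q (N + N) r))"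
    using finite_triple_product[of "fps_X ^ nat l :: 'a fps" "fps_X ^ nat (k - l)" N N]
      theta_term_fps_X[OF assms(1,2), where 'a = 'a]
    unfolding ab by (simp add: sum_distrib_left mult_ac)
  have agree: "fps_agree K ((-1) ^ (r + N) * fps_X ^ ?e r * (qpoch ?q N * qbinomial ?q (N + N) r))
      ((-1) ^ (r + N) * fps_X ^ ?e r)" for r
  proof (cases "K \<le> r \<and> r + K \<le> N + N")
    case True
    then have "fps_agree K (qpoch ?q N * qbinomial ?q (N + N) r) 1"
      using assms by (intro qpoch_qbinomial_agree) auto
    from fps_agree_mult[OF fps_agree_refl this] show ?thesis by simp
  next
    case False
    then have "int K \<le> \<bar>int r - int N\<bar>"
      using assms(3) by linarith
    then have "K \<le> ?e r"
      using abs_le_figurate[OF assms(1,2), of "int r - int N"] by linarith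
    then have "fps_agree K ((-1) ^ (r + N) * fps_X ^ ?e r) ((-1) ^ (r + N) * 0)"
      by (intro fps_agree_mult fps_agree_refl fps_agree_X_power_0)
    then have 0: "fps_agree K ((-1) ^ (r + N) * fps_X ^ ?e r) 0"
      by simp
    from fps_agree_mult[OF this fps_agree_refl]
    have "fps_agree K ((-1) ^ (r + N) * fps_X ^ ?e r * (qpoch ?q N * qbinomial ?q (N + N) r)) 0"
      by (simp only: mult_zero_left)
    then show ?thesis
      using fps_agree_sym[OF 0] by (rule fps_agree_trans)
  qed
  show ?thesis
    unfolding eq by (rule fps_agree_sum) (rule agree)
qed

section \<open>The parts congruent to 0, l or -l\<close>

text \<open>
  The \<open>N\<close> smallest positive integers in each of the classes of \<open>0\<close>, \<open>l\<close> and \<open>- l\<close> modulo \<open>k\<close>,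
  given that \<open>0 < l < k\<close>.
\<close>

definition Jbar_trunc :: "int \<Rightarrow> int \<Rightarrow> nat \<Rightarrow> int set" where
  "Jbar_trunc k l N = (\<lambda>i. k + k * int i) ` {..<N} \<union> (\<lambda>i. l + k * int i) ` {..<N}
    \<union> (\<lambda>i. (k - l) + k * int i) ` {..<N}"

lemma Jbar_trunc_subset:
  assumes "0 < l" "l < k"
  shows "Jbar_trunc k l N \<subseteq> Jbar k l"
proof
  fix m assume "m \<in> Jbar_trunc k l N"
  then obtain i where i: "m = k + k * int i \<or> m = l + k * int i \<or> m = (k - l) + k * int i"
    unfolding Jbar_trunc_def by auto
  have "0 \<le> k * int i"
    using assms by simp
  then have "m > 0"
    using i assms by linarith
  moreover have "k dvd m \<or> k dvd m - l \<or> k dvd m + l"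
    using i by auto
  ultimately show "m \<in> Jbar k l"
    by (auto simp: Jbar_def cong_iff_dvd_diff)
qed

lemma Jbar_subset_trunc:
  assumes "0 < l" "l < k"
  shows "Jbar k l \<inter> {..int N} \<subseteq> Jbar_trunc k l N"
proof
  have *: "\<exists>i<N. m = c + k * int i" 
    if m: "0 < m" "m \<le> int N" and dvd: "k dvd m - c" and c: "0 < c" "c \<le> k" for m c
  proof -
    obtain t where t: "m - c = k * t"
      using dvd by (elim dvdE)
    have "t \<ge> 0"
    proof (rule ccontr)
      assume "\<not> t \<ge> 0"
      then have "k * t \<le> k * (- 1)"
        using assms by (intro mult_left_mono) auto
      then show False using t m c by linarith
    qed
    then have "1 * t \<le> k * t"
      using assms by (intro mult_right_mono) auto
    then have "t < int N"
      using t m c by linarith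
    with \<open>t \<ge> 0\<close> t show ?thesis
      by (intro exI[of _ "nat t"]) auto
  qed
  fix m assume "m \<in> Jbar k l \<inter> {..int N}"
  then have m: "0 < m" "m \<le> int N" and "k dvd m \<or> k dvd m - l \<or> k dvd m + l"
    by (auto simp: Jbar_def cong_iff_dvd_diff)
  moreover have "k dvd m \<longleftrightarrow> k dvd m - k" "k dvd m + l \<longleftrightarrow> k dvd m - (k - l)"
    by (metis dvd_minus_add dvd_refl diff_add_cancel dvd_add_left_iff)
       (metis add_diff_eq diff_diff_eq2 dvd_add_left_iff dvd_refl diff_add_cancel)
  ultimately have "k dvd m - k \<or> k dvd m - l \<or> k dvd m - (k - l)"
    by metis
  then show "m \<in> Jbar_trunc k l N"
  proof (elim disjE)
    assume "k dvd m - k"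
    then show ?thesis
      using *[OF m, of k] assms unfolding Jbar_trunc_def by auto
  next
    assume "k dvd m - l"
    then show ?thesis
      using *[OF m, of l] assms unfolding Jbar_trunc_def by auto
  next
    assume "k dvd m - (k - l)"
    then show ?thesis
      using *[OF m, of "k - l"] assms unfolding Jbar_trunc_def by auto
  qed
qed

lemma prod_Jbar_trunc:
  assumes "0 < l" "l < k" "2 * l \<noteq> k"
  shows "(\<Prod>m\<in>Jbar_trunc k l N. 1 - fps_X ^ nat m)
    = qpoch (fps_X ^ nat k) N * ((\<Prod>i<N. 1 - fps_X ^ nat l * (fps_X ^ nat k) ^ i)
      * (\<Prod>i<N. 1 - fps_X ^ nat (k - l) * (fps_X ^ nat k) ^ i :: 'a::comm_ring_1 fps))"
proof -
  define A where "A c = (\<lambda>i. c + k * int i) ` {..<N}" for c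
  have disj: "A c \<inter> A d = {}" if "\<not> k dvd c - d" for c d
  proof (rule ccontr)
    assume "A c \<inter> A d \<noteq> {}"
    then obtain i j where "c + k * int i = d + k * int j"
      by (auto simp: A_def)
    then have "c - d = k * (int j - int i)"
      by (simp add: algebra_simps)
    then show False using that by simp
  qed
  have nd: "\<not> k dvd x" if "0 < \<bar>x\<bar>" "\<bar>x\<bar> < k" for x
    using that zdvd_not_zless[of "\<bar>x\<bar>" k] by simp
  have "\<not> k dvd k - l" "\<not> k dvd k - (k - l)"
    using assms nd[of "k - l"] nd[of l] by simp_all
  \<comment> \<open>The classes of \<open>l\<close> and \<open>- l\<close> would coincide for \<open>2 * l = k\<close>.\<close>
  moreover have "\<not> k dvd l - (k - l)"
    using assms by (intro nd) linarith+
  ultimately have d: "A k \<inter> A l = {}" "(A k \<union> A l) \<inter> A (k - l) = {}"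
    using disj by (simp_all add: Int_Un_distrib2)
  have pr: "(\<Prod>m\<in>A c. 1 - fps_X ^ nat m) = (\<Prod>i<N. 1 - fps_X ^ nat c * (fps_X ^ nat k) ^ i :: 'a fps)"
    if "0 < c" for c
  proof -
    have "nat (c + k * int i) = nat c + nat k * i" for i
      using that assms by (simp add: nat_add_distrib nat_mult_distrib)
    then have "fps_X ^ nat (c + k * int i) = (fps_X ^ nat c * (fps_X ^ nat k) ^ i :: 'a fps)" for i
      by (simp add: power_add power_mult)
    moreover have "inj_on (\<lambda>i. c + k * int i) {..<N}"
      using assms by (auto simp: inj_on_def)
    ultimately show ?thesis
      unfolding A_def by (simp only: prod.reindex o_def)
  qed
  have "Jbar_trunc k l N = A k \<union> A l \<union> A (k - l)"
    by (simp add: Jbar_trunc_def A_def)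
  moreover have "finite (A c)" for c
    by (simp add: A_def)
  ultimately show ?thesis
    using d assms by (simp add: prod.union_disjoint pr qpoch_def mult.assoc)
qed

section \<open>The recurrence\<close>

text \<open>
  The recurrence with all terms on one side. It is the coefficient of \<open>X ^ n\<close> in the product of the
  generating function and the theta series; as before, \<open>r\<close> stands for the index \<open>j = r - N\<close>.
\<close>

lemma sum_partitions_figurate_eq_0:
  assumes "0 < l" "l < k" "2 * l \<noteq> k" "n > 0" "N = 2 * (n + 1)"
  shows "(\<Sum>r\<le>N + N. (-1) ^ (r + N)
    * real (num_partitions (int n - figurate k l (int r - int N)) (Jbar k l))) = 0"
proof -
  define S where "S = Jbar_trunc k l N"
  let ?e = "\<lambda>r. figurate k l (int r - int N)"
  let ?T = "\<Sum>r\<le>N + N. (-1) ^ (r + N) * fps_X ^ nat (?e r) :: real fps"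
  have S: "S \<subseteq> Jbar k l" "Jbar k l \<inter> {..int N} \<subseteq> S" "finite S"
    using Jbar_trunc_subset[OF assms(1,2)] Jbar_subset_trunc[OF assms(1,2)]
    unfolding S_def by (blast, blast, simp add: Jbar_trunc_def)
  have e: "?e r \<ge> 0" for r
    using abs_le_figurate[OF assms(1,2), of "int r - int N"] by linarith
  have "fps_agree (n + 1) (partitions_fps S * (\<Prod>m\<in>S. 1 - fps_X ^ nat m)) (partitions_fps S * ?T)"
    unfolding S_def prod_Jbar_trunc[OF assms(1-3)]
    by (intro fps_agree_mult fps_agree_refl triple_product_agree[OF assms(1,2,5)])
  also have "partitions_fps S * (\<Prod>m\<in>S. 1 - fps_X ^ nat m) = 1"
    using S Jbar_pos by (intro partitions_fps_prod) auto
  finally have "fps_agree (n + 1) 1 (partitions_fps S * ?T)" .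
  then have "(partitions_fps S * ?T) $ n = 0"
    using assms(4) by (auto simp: fps_agree_def dest!: spec[of _ n])
  also have "partitions_fps S * ?T = (\<Sum>r\<le>N + N. fps_const ((-1) ^ (r + N)) * (fps_X ^ nat (?e r) * partitions_fps S))"
    unfolding sum_distrib_left
  proof (rule sum.cong[OF refl], goal_cases)
    case (1 r)
    have "(-1) ^ (r + N) = fps_const ((-1) ^ (r + N) :: real)"
      by (metis fps_const_1_eq_1 fps_const_neg fps_const_power)
    then show ?case
      by (simp only: mult_ac)
  qed
  also have "\<dots> $ n = (\<Sum>r\<le>N + N. (-1) ^ (r + N) * real (num_partitions (int n - ?e r) (Jbar k l)))"
    unfolding fps_sum_nth
  proof (rule sum.cong[OF refl], goal_cases)
    case (1 r)
    have "(fps_X ^ nat (?e r) * partitions_fps S) $ n = real (num_partitions (int n - ?e r) (Jbar k l))"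
    proof (cases "n < nat (?e r)")
      case True
      then show ?thesis
        using num_partitions_neg[OF Jbar_pos] by (simp add: fps_X_power_mult_nth)
    next
      case False
      then have "int (n - nat (?e r)) = int n - ?e r"
        using e[of r] by linarith
      moreover have "num_partitions (int n - ?e r) S = num_partitions (int n - ?e r) (Jbar k l)"
        using S e[of r] assms(5) by (intro num_partitions_restrict_parts[of _ "int N"] Jbar_pos) auto
      ultimately show ?thesis
        using False by (simp add: fps_X_power_mult_nth partitions_fps_def)
    qed
    then show ?case by simp
  qed
  finally show ?thesis .
qed

lemma figurate_uminus: "figurate k l (- j) = figurate k (k - l) j"
proof -
  have "2 * figurate k l (- j) = 2 * figurate k (k - l) j"
    by (simp add: figurate_def distrib_left) (simp add: algebra_simps)
  then show ?thesis by simp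
qed

theorem theorem2p2:
  fixes k l n :: int
  assumes "k \<ge> 3" and "0 < l" and "l < k" and "real_of_int l \<noteq> real_of_int k / 2" and "n > 0"
  shows "real (num_partitions n (Jbar k l))
           = (\<Sum>\<^sub>\<infinity>j\<in>UNIV - {0}.
                (-1) powi (j - 1) * real (num_partitions (n - figurate k l j) (Jbar k l)))
         \<and> (\<Sum>\<^sub>\<infinity>j\<in>UNIV - {0}.
                (-1) powi (j - 1) * real (num_partitions (n - figurate k l j) (Jbar k l)))
           = (\<Sum>\<^sub>\<infinity>j\<in>{1..}.
                (-1) powi (j - 1) * real (num_partitions (n - figurate k l j) (Jbar k l)))
             + (\<Sum>\<^sub>\<infinity>j\<in>{1..}.
                (-1) powi (j - 1) * real (num_partitions (n - figurate k (k - l) j) (Jbar k l)))"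
proof -
  define g where "g j = (-1) powi (j - 1) * real (num_partitions (n - figurate k l j) (Jbar k l))" for j
  define N where "N = 2 * (nat n + 1)"
  \<comment> \<open>As \<open>\<bar>j\<bar> \<le> figurate k l j\<close>, all infinite sums are sums over \<open>{- N..N}\<close>.\<close>
  have supp: "g j = 0" if "j \<notin> {- int N..int N}" for j
  proof -
    have "n - figurate k l j < 0"
      using that abs_le_figurate[OF assms(2,3), of j] assms(5) by (auto simp: N_def)
    then show ?thesis
      using num_partitions_neg[OF Jbar_pos] by (simp add: g_def)
  qed
  have "2 * l \<noteq> k"
    using assms(4) by linarith
  then have "(\<Sum>r\<le>N + N. (-1) ^ (r + N)
      * real (num_partitions (n - figurate k l (int r - int N)) (Jbar k l))) = 0"
    using sum_partitions_figurate_eq_0[of l k "nat n" N] assms by (simp add: N_def)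
  also have "(\<Sum>r\<le>N + N. (-1) ^ (r + N)
      * real (num_partitions (n - figurate k l (int r - int N)) (Jbar k l)))
      = (\<Sum>r\<le>N + N. - g (int r - int N))"
    by (rule sum.cong) (auto simp: g_def power_int_minus_left power_int_diff)
  also have "\<dots> = (\<Sum>j\<in>{- int N..int N}. - g j)"
    by (rule sum.reindex_bij_witness[of _ "\<lambda>j. nat (j + int N)" "\<lambda>r. int r - int N"]) auto
  also have "\<dots> = - (g 0 + sum g ({- int N..int N} - {0}))"
    by (subst sum.remove[of _ 0]) (auto simp: sum_negf)
  also have "g 0 = - real (num_partitions n (Jbar k l))"
    by (simp add: g_def figurate_def)
  also have "sum g ({- int N..int N} - {0}) = infsum g ({- int N..int N} - {0})"
    by simp
  also have "\<dots> = infsum g (UNIV - {0})"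
    using supp by (intro infsum_cong_neutral) auto
  finally have first: "real (num_partitions n (Jbar k l)) = infsum g (UNIV - {0})"
    by simp
  have summable: "g summable_on A" for A
  proof -
    have "g summable_on ({- int N..int N} \<inter> A)"
      by simp
    also have "?this \<longleftrightarrow> g summable_on A"
      using supp by (intro summable_on_cong_neutral) auto
    finally show ?thesis .
  qed
  have "UNIV - {0} = {1..} \<union> {..-1::int}"
    by auto
  then have "infsum g (UNIV - {0}) = infsum g {1..} + infsum g {..-1}"
    by (simp only:) (intro infsum_Un_disjoint summable, simp add: disjoint_iff)
  also have "infsum g {..-1} = (\<Sum>\<^sub>\<infinity>j\<in>{1..}. g (- j))"
    by (rule infsum_reindex_bij_witness[of _ uminus uminus]) auto
  also have "(\<lambda>j. g (- j))
      = (\<lambda>j. (-1) powi (j - 1) * real (num_partitions (n - figurate k (k - l) j) (Jbar k l)))"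
    by (auto simp: g_def figurate_uminus power_int_minus_left power_int_diff fun_eq_iff)
  finally show ?thesis
    using first unfolding g_def[abs_def] by simp
qed

end
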